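(* Let $(\widehat X_i)_{i\ge 1}$ be independent (not necessarily identically distributed) random variables with values in $\mathbb{N}_0=\{0,1,2,\dots\}$, with probability mass functions $\widehat f_i(k)=P(\widehat X_i=k)$. For $n\ge 1$ let $\widehat Y_n=\sum_{i=1}^n\widehat X_i$, $\widehat Z_n=\max_{1\le i\le n}\widehat X_i$, $\widehat g_n(l,m)=P(\widehat Y_n=l,\ \widehat Z_n=m)$, and $\widehat{\mathcal D}_n=\{(l,m)\in\mathbb{N}_0^2: m\le l\le nm\}$. Then for all integers $n\ge 2$ and all $(l,m)\in\widehat{\mathcal D}_n$, $$\begin{aligned}\widehat g_n(l,m)&=\widehat f_n(m)\sum_{k=0}^m\widehat g_{n-1}(l-m,k)+\sum_{k=0}^{m-1}\widehat f_n(k)\,\widehat g_{n-1}(l-k,m)\\&=\widehat f_n(m)\sum_{k=\left\lceil\frac{l-m}{n-1}\right\rceil}^{\min(l-m,m)}\widehat g_{n-1}(l-m,k)+\sum_{k=\max(l-(n-1)m,\,0)}^{\min(l-m,\,m-1)}\widehat f_n(k)\,\widehat g_{n-1}(l-k,m),\end{aligned}$$ with initial condition $$\widehat g_1(l,m)=\widehat f_1(l)=\widehat f_1(m),\qquad\forall (l,m)\in\widehat{\mathcal D}_1.$$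
   Context: $\widehat g_n(l,m)=0$ for all integer pairs $(l,m)\notin\widehat{\mathcal D}_n$. A sum whose upper limit is smaller than its lower limit equals $0$. *)

theory Defs
  imports "HOL-Probability.Probability"
begin

text \<open>
  The sequence \<open>X i\<close> of random variables is used for \<open>i \<ge> 1\<close> only. All masses take integer
  arguments, so that differences such as \<open>l - k\<close> are not truncated, summation ranges such as
  \<open>{0..m - 1}\<close> with \<open>m = 0\<close> are empty, and the joint mass is available at arbitrary integer pairs.
\<close>

definition pmass :: "'a measure \<Rightarrow> (nat \<Rightarrow> 'a \<Rightarrow> nat) \<Rightarrow> nat \<Rightarrow> int \<Rightarrow> real" where
  "pmass M X i k = \<P>(\<omega> in M. int (X i \<omega>) = k)"

definition partial_sum :: "(nat \<Rightarrow> 'a \<Rightarrow> nat) \<Rightarrow> nat \<Rightarrow> 'a \<Rightarrow> nat" where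
  "partial_sum X n \<omega> = (\<Sum>i=1..n. X i \<omega>)"

definition partial_max :: "(nat \<Rightarrow> 'a \<Rightarrow> nat) \<Rightarrow> nat \<Rightarrow> 'a \<Rightarrow> nat" where
  "partial_max X n \<omega> = Max ((\<lambda>i. X i \<omega>) ` {1..n})"

definition joint_mass :: "'a measure \<Rightarrow> (nat \<Rightarrow> 'a \<Rightarrow> nat) \<Rightarrow> nat \<Rightarrow> int \<Rightarrow> int \<Rightarrow> real" where
  "joint_mass M X n l m =
     \<P>(\<omega> in M. int (partial_sum X n \<omega>) = l \<and> int (partial_max X n \<omega>) = m)"

definition joint_dom :: "nat \<Rightarrow> (int \<times> int) set" where
  "joint_dom n = {(l, m). 0 \<le> l \<and> 0 \<le> m \<and> m \<le> l \<and> l \<le> int n * m}"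

text \<open>The convention that the joint mass vanishes off its domain holds by the definitions.\<close>

lemma joint_mass_eq_0:
  assumes n: "n \<ge> 1" and notin: "(l, m) \<notin> joint_dom n"
  shows "joint_mass M X n l m = 0"
proof -
  have "\<not> (int (partial_sum X n \<omega>) = l \<and> int (partial_max X n \<omega>) = m)" for \<omega>
  proof
    assume *: "int (partial_sum X n \<omega>) = l \<and> int (partial_max X n \<omega>) = m"
    let ?A = "(\<lambda>i. X i \<omega>) ` {1..n}"
    have "partial_max X n \<omega> \<in> ?A"
      unfolding partial_max_def using n by (intro Max_in) auto
    then obtain j where j: "j \<in> {1..n}" "partial_max X n \<omega> = X j \<omega>"
      by auto
    have lower: "partial_max X n \<omega> \<le> partial_sum X n \<omega>"
      unfolding j(2) partial_sum_def using j(1) by (intro member_le_sum) auto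
    have "X i \<omega> \<le> partial_max X n \<omega>" if "i \<in> {1..n}" for i
      unfolding partial_max_def using that by (intro Max_ge) auto
    then have "partial_sum X n \<omega> \<le> card {1..n} * partial_max X n \<omega>"
      unfolding partial_sum_def using sum_bounded_above[of "{1..n}" "\<lambda>i. X i \<omega>"] by simp
    then have "int (partial_sum X n \<omega>) \<le> int n * int (partial_max X n \<omega>)"
      by (simp flip: of_nat_mult)
    with lower * notin show False
      by (auto simp: joint_dom_def)
  qed
  then have "{\<omega> \<in> space M. int (partial_sum X n \<omega>) = l \<and> int (partial_max X n \<omega>) = m} = {}"
    by blast
  then show ?thesis
    unfolding joint_mass_def by (simp only: measure_empty)
qed

end

theory Submission
  imports Defs
begin

text \<open>
  Condition on the pair of the last variable and the previous maximum: the event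
  \<open>Y\<^sub>n = l, Z\<^sub>n = m\<close> is the disjoint union of the events
  \<open>X\<^sub>n = a, Y\<^bsub>n-1\<^esub> = l - a, Z\<^bsub>n-1\<^esub> = b\<close> over the pairs \<open>(a, b)\<close> with \<open>max a b = m\<close>, and
  \<open>X\<^sub>n\<close> is independent of \<open>(Y\<^bsub>n-1\<^esub>, Z\<^bsub>n-1\<^esub>)\<close>. The second form drops terms that vanish off
  the domain.
\<close>

lemma partial_sum_Suc: "partial_sum X (Suc n) \<omega> = partial_sum X n \<omega> + X (Suc n) \<omega>"
  by (simp add: partial_sum_def)

text \<open>The hypothesis excludes \<open>n = 0\<close>, where \<open>partial_max X 0\<close> is
  \<open>Max {}\<close>, an unspecified value.\<close>

lemma partial_max_Suc:
  assumes "n \<ge> 1"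
  shows "partial_max X (Suc n) \<omega> = max (partial_max X n \<omega>) (X (Suc n) \<omega>)"
proof -
  have "{1..Suc n} = insert (Suc n) {1..n}" by auto
  with assms show ?thesis
    by (simp add: partial_max_def max.commute)
qed

context prob_space
begin

text \<open>
  The dummy component \<open>0\<close> is there because \<open>indep_var\<close> wants both variables to have the same type.
\<close>

lemma indep_var_partial_sum_max:
  assumes "indep_vars (\<lambda>_. count_space UNIV) X {1..}"
  shows "indep_var (count_space UNIV) (\<lambda>\<omega>. (X (Suc n) \<omega>, 0))
    (count_space UNIV) (\<lambda>\<omega>. (partial_sum X n \<omega>, partial_max X n \<omega>))"
proof -
  let ?C = "count_space UNIV :: nat measure"
  \<comment> \<open>\<open>f\<close> and \<open>g\<close> recover the two pairs from the coordinates
    in the disjoint blocks \<open>{Suc n}\<close> and \<open>{1..n}\<close>, whose restrictions are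
    independent.\<close>
  define f where "f = (\<lambda>x::nat \<Rightarrow> nat. (x (Suc n), 0::nat))"
  define g where "g = (\<lambda>x::nat \<Rightarrow> nat. (sum x {1..n}, Max (x ` {1..n})))"
  \<comment> \<open>A finite product of discrete countable spaces is again discrete, so
    \<open>f\<close> and \<open>g\<close> are measurable for free.\<close>
  have PiM: "PiM J (\<lambda>_. ?C) = count_space (PiE J (\<lambda>_. UNIV))" if "finite J" for J :: "nat set"
    using that by (intro count_space_PiM_finite) auto
  have "indep_var (PiM {Suc n} (\<lambda>_. ?C)) (\<lambda>\<omega>. restrict (\<lambda>i. X i \<omega>) {Suc n})
      (PiM {1..n} (\<lambda>_. ?C)) (\<lambda>\<omega>. restrict (\<lambda>i. X i \<omega>) {1..n})"
    by (rule indep_var_restrict[OF assms]) auto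
  then have "indep_var (count_space UNIV) (f \<circ> (\<lambda>\<omega>. restrict (\<lambda>i. X i \<omega>) {Suc n}))
      (count_space UNIV) (g \<circ> (\<lambda>\<omega>. restrict (\<lambda>i. X i \<omega>) {1..n}))"
    by (rule indep_var_compose) (simp_all add: PiM)
  moreover have "f \<circ> (\<lambda>\<omega>. restrict (\<lambda>i. X i \<omega>) {Suc n}) = (\<lambda>\<omega>. (X (Suc n) \<omega>, 0))"
    by (simp add: f_def fun_eq_iff)
  moreover have "g \<circ> (\<lambda>\<omega>. restrict (\<lambda>i. X i \<omega>) {1..n})
      = (\<lambda>\<omega>. (partial_sum X n \<omega>, partial_max X n \<omega>))"
    by (simp add: g_def fun_eq_iff partial_sum_def partial_max_def)
  ultimately show ?thesis by simp
qed

text \<open>All three events are preimages of sets under discrete-valued random variables, hence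
  measurable. The third is the event of a rectangle \<open>?A \<times> ?B\<close>, so its
  probability factors by independence.\<close>

lemma
  assumes "indep_vars (\<lambda>_. count_space UNIV) X {1..}"
  shows joint_mass_event:
      "{\<omega> \<in> space M. int (partial_sum X n \<omega>) = l \<and> int (partial_max X n \<omega>) = m} \<in> events"
    and joint_mass_Suc_event:
      "{\<omega> \<in> space M. int (X (Suc n) \<omega>) = k
        \<and> int (partial_sum X n \<omega>) = l \<and> int (partial_max X n \<omega>) = m} \<in> events"
    and prob_Suc_joint_mass:
      "\<P>(\<omega> in M. int (X (Suc n) \<omega>) = k
          \<and> int (partial_sum X n \<omega>) = l \<and> int (partial_max X n \<omega>) = m)
        = pmass M X (Suc n) k * joint_mass M X n l m"
proof -
  let ?U = "\<lambda>\<omega>. (X (Suc n) \<omega>, 0)"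
  let ?V = "\<lambda>\<omega>. (partial_sum X n \<omega>, partial_max X n \<omega>)"
  let ?A = "{(a, b::nat). int a = k}" and ?B = "{(a, b). int a = l \<and> int b = m}"
  note iv = indep_var_partial_sum_max[OF assms, of n]
  have A: "{\<omega> \<in> space M. int (X (Suc n) \<omega>) = k} = ?U -` ?A \<inter> space M"
    and B: "{\<omega> \<in> space M. int (partial_sum X n \<omega>) = l \<and> int (partial_max X n \<omega>) = m}
      = ?V -` ?B \<inter> space M"
    and AB: "{\<omega> \<in> space M. int (X (Suc n) \<omega>) = k
        \<and> int (partial_sum X n \<omega>) = l \<and> int (partial_max X n \<omega>) = m}
      = (\<lambda>\<omega>. (?U \<omega>, ?V \<omega>)) -` (?A \<times> ?B) \<inter> space M"
    by auto
  have evA: "?U -` ?A \<inter> space M \<in> events"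
    by (rule measurable_sets[OF indep_var_rv1[OF iv]]) simp
  have evB: "?V -` ?B \<inter> space M \<in> events"
    by (rule measurable_sets[OF indep_var_rv2[OF iv]]) simp
  show "{\<omega> \<in> space M. int (partial_sum X n \<omega>) = l \<and> int (partial_max X n \<omega>) = m} \<in> events"
    unfolding B by (rule evB)
  have "(\<lambda>\<omega>. (?U \<omega>, ?V \<omega>)) -` (?A \<times> ?B) \<inter> space M
      = (?U -` ?A \<inter> space M) \<inter> (?V -` ?B \<inter> space M)"
    by auto
  then show "{\<omega> \<in> space M. int (X (Suc n) \<omega>) = k
        \<and> int (partial_sum X n \<omega>) = l \<and> int (partial_max X n \<omega>) = m} \<in> events"
    unfolding AB using evA evB by simp
  show "\<P>(\<omega> in M. int (X (Suc n) \<omega>) = k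
          \<and> int (partial_sum X n \<omega>) = l \<and> int (partial_max X n \<omega>) = m)
        = pmass M X (Suc n) k * joint_mass M X n l m"
    unfolding pmass_def joint_mass_def A B AB by (rule indep_varD[OF iv]) simp_all
qed

lemma joint_mass_Suc:
  assumes "indep_vars (\<lambda>_. count_space UNIV) X {1..}" and "n \<ge> 1" and "m \<ge> 0"
  shows "joint_mass M X (Suc n) l m =
    pmass M X (Suc n) m * (\<Sum>k\<in>{0..m}. joint_mass M X n (l - m) k)
    + (\<Sum>k\<in>{0..m - 1}. pmass M X (Suc n) k * joint_mass M X n (l - k) m)"
proof -
  let ?t = "\<lambda>(a, b). pmass M X (Suc n) a * joint_mass M X n (l - a) b"
  \<comment> \<open>\<open>I\<close> holds the pairs in which the last variable attains the maximum
    \<open>m\<close>, \<open>J\<close> those in which it stays below \<open>m\<close>. The pair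
    \<open>(m, m)\<close> is counted in \<open>I\<close> only, so the union is disjoint; this is why
    the second sum stops at \<open>m - 1\<close>.\<close>
  define I J where "I = Pair m ` {0..m}" and "J = (\<lambda>k. (k, m)) ` {0..m - 1}"
  have "joint_mass M X (Suc n) l m = (\<Sum>p\<in>I \<union> J. \<P>(\<omega> in M. int (X (Suc n) \<omega>) = fst p
      \<and> int (partial_sum X n \<omega>) = l - fst p \<and> int (partial_max X n \<omega>) = snd p))"
    unfolding joint_mass_def
  proof (rule prob_sum)
    show "AE \<omega> in M. (\<forall>p\<in>I \<union> J. int (X (Suc n) \<omega>) = fst p
          \<and> int (partial_sum X n \<omega>) = l - fst p \<and> int (partial_max X n \<omega>) = snd p \<longrightarrow>
          int (partial_sum X (Suc n) \<omega>) = l \<and> int (partial_max X (Suc n) \<omega>) = m)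
        \<and> (int (partial_sum X (Suc n) \<omega>) = l \<and> int (partial_max X (Suc n) \<omega>) = m \<longrightarrow>
          (\<exists>!p\<in>I \<union> J. int (X (Suc n) \<omega>) = fst p
            \<and> int (partial_sum X n \<omega>) = l - fst p \<and> int (partial_max X n \<omega>) = snd p))"
    proof (rule AE_I2, intro conjI impI)
      fix \<omega>
      show "\<forall>p\<in>I \<union> J. int (X (Suc n) \<omega>) = fst p
          \<and> int (partial_sum X n \<omega>) = l - fst p \<and> int (partial_max X n \<omega>) = snd p \<longrightarrow>
          int (partial_sum X (Suc n) \<omega>) = l \<and> int (partial_max X (Suc n) \<omega>) = m"
        using \<open>n \<ge> 1\<close> by (auto simp: I_def J_def partial_sum_Suc partial_max_Suc)
      assume "int (partial_sum X (Suc n) \<omega>) = l \<and> int (partial_max X (Suc n) \<omega>) = m"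
      then have eqs: "int (partial_sum X n \<omega>) = l - int (X (Suc n) \<omega>)"
          "max (int (partial_max X n \<omega>)) (int (X (Suc n) \<omega>)) = m"
        using \<open>n \<ge> 1\<close> by (auto simp: partial_sum_Suc partial_max_Suc)
      show "\<exists>!p\<in>I \<union> J. int (X (Suc n) \<omega>) = fst p
            \<and> int (partial_sum X n \<omega>) = l - fst p \<and> int (partial_max X n \<omega>) = snd p"
      \<comment> \<open>The witness is the pair observed at \<open>\<omega>\<close>; uniqueness is
        immediate, since the equations fix both components of \<open>p\<close>.\<close>
      proof (rule ex1I[of _ "(int (X (Suc n) \<omega>), int (partial_max X n \<omega>))"])
        show "(int (X (Suc n) \<omega>), int (partial_max X n \<omega>)) \<in> I \<union> J \<and>
            int (X (Suc n) \<omega>) = fst (int (X (Suc n) \<omega>), int (partial_max X n \<omega>))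
            \<and> int (partial_sum X n \<omega>) = l - fst (int (X (Suc n) \<omega>), int (partial_max X n \<omega>))
            \<and> int (partial_max X n \<omega>) = snd (int (X (Suc n) \<omega>), int (partial_max X n \<omega>))"
          using eqs by (auto simp: I_def J_def image_iff max_def split: if_splits)
      qed auto
    qed
  qed (auto simp: I_def J_def intro: joint_mass_event joint_mass_Suc_event assms(1))
  also have "\<dots> = sum ?t (I \<union> J)"
    by (intro sum.cong refl) (auto simp: prob_Suc_joint_mass[OF assms(1)])
  also have "\<dots> = sum ?t I + sum ?t J"
    by (rule sum.union_disjoint) (auto simp: I_def J_def)
  also have "sum ?t I = pmass M X (Suc n) m * (\<Sum>k\<in>{0..m}. joint_mass M X n (l - m) k)"
    by (simp add: I_def sum.reindex inj_on_def sum_distrib_left)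
  also have "sum ?t J = (\<Sum>k\<in>{0..m - 1}. pmass M X (Suc n) k * joint_mass M X n (l - k) m)"
    by (simp add: J_def sum.reindex inj_on_def)
  finally show ?thesis .
qed

end

text \<open>The omitted \<open>k\<close> satisfy \<open>k > l\<close> or \<open>l > n * k\<close>,
  so \<open>(l, k)\<close> lies off the domain and the term vanishes. Nonnegativity of
  \<open>l\<close> keeps the ceiling from falling below \<open>0\<close>.\<close>

lemma sum_joint_mass_restrict_max:
  assumes "n \<ge> 1" and "l \<ge> 0"
  shows "(\<Sum>k\<in>{0..m}. joint_mass M X n l k)
    = (\<Sum>k\<in>{\<lceil>real_of_int l / real n\<rceil>..min l m}. joint_mass M X n l k)"
proof (rule sum.mono_neutral_right)
  \<comment> \<open>Clearing the denominator turns the ceiling bound into the upper bound in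
    \<open>joint_dom\<close>.\<close>
  have le_iff: "\<lceil>real_of_int l / real n\<rceil> \<le> k \<longleftrightarrow> l \<le> int n * k" for k
  proof -
    have "\<lceil>real_of_int l / real n\<rceil> \<le> k \<longleftrightarrow> real_of_int l \<le> real_of_int (int n * k)"
      using assms(1) by (simp add: ceiling_le_iff divide_le_eq mult.commute)
    then show ?thesis by (simp only: of_int_le_iff)
  qed
  have nonneg: "0 \<le> \<lceil>real_of_int l / real n\<rceil>"
    using divide_nonneg_nonneg[of "real_of_int l" "real n"] assms(2) by linarith
  then show "{\<lceil>real_of_int l / real n\<rceil>..min l m} \<subseteq> {0..m}" by auto
  show "\<forall>k\<in>{0..m} - {\<lceil>real_of_int l / real n\<rceil>..min l m}. joint_mass M X n l k = 0"
    using assms(1) by (auto intro!: joint_mass_eq_0 simp: joint_dom_def le_iff)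
qed simp

text \<open>Here an omitted \<open>k\<close> gives \<open>l - k < m\<close> or
  \<open>l - k > n * m\<close>, again off the domain. The weight \<open>f\<close> is
  arbitrary.\<close>

lemma sum_joint_mass_restrict_last:
  assumes "n \<ge> 1"
  shows "(\<Sum>k\<in>{0..m - 1}. f k * joint_mass M X n (l - k) m)
    = (\<Sum>k\<in>{max (l - int n * m) 0..min (l - m) (m - 1)}. f k * joint_mass M X n (l - k) m)"
proof (rule sum.mono_neutral_right)
  show "\<forall>k\<in>{0..m - 1} - {max (l - int n * m) 0..min (l - m) (m - 1)}.
      f k * joint_mass M X n (l - k) m = 0"
  proof
    fix k assume "k \<in> {0..m - 1} - {max (l - int n * m) 0..min (l - m) (m - 1)}"
    then have "(l - k, m) \<notin> joint_dom n" by (auto simp: joint_dom_def)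
    with assms show "f k * joint_mass M X n (l - k) m = 0" by (simp add: joint_mass_eq_0)
  qed
qed auto

lemma joint_mass_1: "joint_mass M X 1 l l = pmass M X 1 l"
  by (simp add: joint_mass_def pmass_def partial_sum_def partial_max_def)

theorem theorem3p3:
  fixes M :: "'a measure" and X :: "nat \<Rightarrow> 'a \<Rightarrow> nat"
  assumes "prob_space M"
    and "prob_space.indep_vars M (\<lambda>_. count_space UNIV) X {1..}"
  shows "(\<forall>n::nat. \<forall>l m::int. n \<ge> 2 \<and> (l, m) \<in> joint_dom n \<longrightarrow>
            joint_mass M X n l m =
              pmass M X n m * (\<Sum>k\<in>{0..m}. joint_mass M X (n - 1) (l - m) k)
              + (\<Sum>k\<in>{0..m - 1}. pmass M X n k * joint_mass M X (n - 1) (l - k) m)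
          \<and> joint_mass M X n l m =
              pmass M X n m *
                (\<Sum>k\<in>{\<lceil>real_of_int (l - m) / (real n - 1)\<rceil>..min (l - m) m}.
                   joint_mass M X (n - 1) (l - m) k)
              + (\<Sum>k\<in>{max (l - (int n - 1) * m) 0..min (l - m) (m - 1)}.
                   pmass M X n k * joint_mass M X (n - 1) (l - k) m))
       \<and> (\<forall>l m::int. (l, m) \<in> joint_dom 1 \<longrightarrow>
            joint_mass M X 1 l m = pmass M X 1 l \<and> pmass M X 1 l = pmass M X 1 m)"
proof (intro conjI allI impI)
  interpret prob_space M by fact
  fix n :: nat and l m :: int
  assume nlm: "n \<ge> 2 \<and> (l, m) \<in> joint_dom n"
  \<comment> \<open>With \<open>n = Suc p\<close> the recursion applies, and the truncated, real and
    integer forms of \<open>n - 1\<close> all become \<open>p\<close>.\<close>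
  define p where "p = n - 1"
  have n: "n = Suc p" "n - 1 = p" "p \<ge> 1" "real n - 1 = real p" "int n - 1 = int p"
    using nlm by (auto simp: p_def)
  have lm: "0 \<le> m" "0 \<le> l - m"
    using nlm by (auto simp: joint_dom_def)
  show rec: "joint_mass M X n l m =
      pmass M X n m * (\<Sum>k\<in>{0..m}. joint_mass M X (n - 1) (l - m) k)
      + (\<Sum>k\<in>{0..m - 1}. pmass M X n k * joint_mass M X (n - 1) (l - k) m)"
    using joint_mass_Suc[OF assms(2) \<open>p \<ge> 1\<close> lm(1)] by (simp add: n)
  show "joint_mass M X n l m =
      pmass M X n m *
        (\<Sum>k\<in>{\<lceil>real_of_int (l - m) / (real n - 1)\<rceil>..min (l - m) m}.
           joint_mass M X (n - 1) (l - m) k)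
      + (\<Sum>k\<in>{max (l - (int n - 1) * m) 0..min (l - m) (m - 1)}.
           pmass M X n k * joint_mass M X (n - 1) (l - k) m)"
    unfolding rec n(2,4,5)
    by (simp only: sum_joint_mass_restrict_max[OF n(3) lm(2)]
        sum_joint_mass_restrict_last[OF n(3)])
next
  fix l m :: int
  assume "(l, m) \<in> joint_dom 1"
  \<comment> \<open>For a single variable the bounds \<open>m \<le> l \<le> 1 * m\<close> reduce the
    domain to the diagonal.\<close>
  then have "m = l" by (auto simp: joint_dom_def)
  then show "joint_mass M X 1 l m = pmass M X 1 l" and "pmass M X 1 l = pmass M X 1 m"
    by (simp_all only: joint_mass_1)
qed

end
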